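(* Let $n\ge 1$, let $s\in\{-n+1,\dots,n-1\}^n$ be an integer vector, and let $x=(x_{-n+1},\dots,x_{n-1})\in\mathbb{N}^{2n-1}$ be its frequency vector. Then $s$ satisfies the permutohedral constraints (i.e. $s$ is a score vector) if and only if $x$ satisfies the equation $$\sum_{d=-n+1}^{n-1}x_d=n$$ and, for all integers $k=0,\dots,n$, the inequalities $$\sum_{i=1}^{2k}(2k-i+1)\,x_{-n+i}\le k(k+1)\qquad\text{and}\qquad \sum_{i=1}^{2k}(2k-i+1)\,x_{n-i}\le k(k+1),$$ where by convention $x_{-n}=x_n=0$.
   Context: Write $[n]=\{1,\dots,n\}$. A vector $s=(s_1,\dots,s_n)\in\mathbb{Z}^n$ satisfies the permutohedral constraints (equivalently, is called a score vector) if $\left|\sum_{i\in I}s_i\right|\le |I|(n-|I|)$ for all $I\subseteq[n]$. The frequency vector of $s\in\{-n+1,\dots,n-1\}^n$ is $x=(x_{-n+1},\dots,x_{n-1})\in\mathbb{N}^{2n-1}$, where $x_d$ is the number of indices $i\in[n]$ with $s_i=d$. Here $\mathbb{N}$ includes $0$. *)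

theory Defs
  imports Main "HOL-Library.FuncSet"
begin

text \<open>A vector in \<open>\<int>\<^sup>n\<close> is a function \<open>s\<close> on \<open>nat\<close> of which only the entries
  \<open>s 1, \<dots>, s n\<close> are read.\<close>

definition score_vector :: "nat \<Rightarrow> (nat \<Rightarrow> int) \<Rightarrow> bool" where
  "score_vector n s \<longleftrightarrow>
     (\<forall>I\<subseteq>{1..n}. \<bar>\<Sum>i\<in>I. s i\<bar> \<le> int (card I) * (int n - int (card I)))"

text \<open>The frequency vector has entries for \<open>-n+1 \<le> d \<le> n-1\<close>. It is extended by zero
  to all integers, which includes the convention \<open>x\<^sub>-\<^sub>n = x\<^sub>n = 0\<close>.\<close>

definition frequency_vector :: "nat \<Rightarrow> (nat \<Rightarrow> int) \<Rightarrow> int \<Rightarrow> nat" where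
  "frequency_vector n s d =
     (if d \<in> {- int n + 1..int n - 1} then card {i \<in> {1..n}. s i = d} else 0)"

end

theory Submission
  imports Defs
begin

text \<open>Each half of the permutohedral constraints is a statement about a vector \<open>t\<close> of
  integers: with \<open>t i = n + s i\<close> for the lower bounds and \<open>t i = n - s i\<close> for the
  upper bounds, the constraint at \<open>I\<close> says that \<open>t\<close> sums over \<open>I\<close> to at least \<open>m\<^sup>2\<close>, where
  \<open>m\<close> is the size of \<open>I\<close> (\<open>score_vector_iff_square_le_sum\<close>). On the other side, counting the
  indices one by one instead of by their value turns the two weighted frequency sums into
  \<open>\<Sum>i. max 0 (2 k + 1 - t i)\<close> (\<open>weighted_frequency_sum\<close>).

  The two families of inequalities are linked by duality (\<open>square_le_sum_iff_excess_le\<close>). The sum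
  of positive parts is the maximum over \<open>I\<close> of \<open>\<Sum>i\<in>I. (2 k + 1 - t i)\<close>, attained at
  \<open>I = {i. t i \<le> 2 k}\<close>, and the constraints bound the sum over \<open>I\<close> by \<open>m (2 k + 1 - m)\<close>. Among
  integers \<open>m\<close> this quadratic is largest at \<open>m = k\<close> and \<open>m = k + 1\<close>, with value \<open>k (k + 1)\<close>.
  So the constraints imply the inequalities; conversely, the inequality for \<open>k = m\<close> is
  sharp for sets of size \<open>m\<close> and returns exactly their constraint.\<close>

text \<open>This is conjugacy between the convex sequences \<open>m\<^sup>2\<close> and \<open>k (k + 1)\<close>, the latter being
  \<open>max\<^sub>m (m (2 k + 1) - m\<^sup>2)\<close>. Only the odd slopes \<open>2 k + 1\<close> are needed, because these are the
  differences of consecutive squares.\<close>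

lemma square_le_sum_iff_excess_le:
  fixes t :: "'a \<Rightarrow> int"
  assumes "finite A"
  shows "(\<forall>I\<subseteq>A. int (card I) ^ 2 \<le> (\<Sum>i\<in>I. t i)) \<longleftrightarrow>
    (\<forall>k\<le>card A. (\<Sum>i\<in>A. max 0 (2 * int k + 1 - t i)) \<le> int k * (int k + 1))"
    (is "?squares \<longleftrightarrow> ?excess")
proof
  assume sq: ?squares
  show ?excess
  proof (intro allI impI)
    fix k
    define I where "I = {i \<in> A. t i \<le> 2 * int k}"
    define m where "m = int (card I)"
    have "(\<Sum>i\<in>A. max 0 (2 * int k + 1 - t i)) = (\<Sum>i\<in>I. 2 * int k + 1 - t i)"
      unfolding I_def by (rule sum.mono_neutral_cong_right) (use assms in auto)
    also have "\<dots> = m * (2 * int k + 1) - (\<Sum>i\<in>I. t i)"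
      by (simp add: sum_subtractf m_def)
    also have "\<dots> \<le> m * (2 * int k + 1) - m ^ 2"
      using sq by (simp add: I_def m_def)
    also have "\<dots> \<le> int k * (int k + 1)"
    proof -
      \<comment> \<open>The difference of the two sides is a product of consecutive integers.\<close>
      have "0 \<le> (int k - m) * (int k + 1 - m)"
        by (cases "m \<le> int k") (auto intro: mult_nonneg_nonneg mult_nonpos_nonpos)
      then show ?thesis
        by (simp add: algebra_simps power2_eq_square)
    qed
    finally show "(\<Sum>i\<in>A. max 0 (2 * int k + 1 - t i)) \<le> int k * (int k + 1)" .
  qed
next
  assume ex: ?excess
  show ?squares
  proof (intro allI impI)
    fix I assume "I \<subseteq> A"
    define m where "m = int (card I)"
    have "m * (2 * m + 1) - (\<Sum>i\<in>I. t i) = (\<Sum>i\<in>I. 2 * m + 1 - t i)"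
      by (simp add: sum_subtractf m_def)
    also have "\<dots> \<le> (\<Sum>i\<in>I. max 0 (2 * m + 1 - t i))"
      by (rule sum_mono) simp
    also have "\<dots> \<le> (\<Sum>i\<in>A. max 0 (2 * m + 1 - t i))"
      by (rule sum_mono2) (use assms \<open>I \<subseteq> A\<close> in auto)
    also have "\<dots> \<le> m * (m + 1)"
      using ex card_mono[OF assms \<open>I \<subseteq> A\<close>] by (simp add: m_def)
    finally show "int (card I) ^ 2 \<le> (\<Sum>i\<in>I. t i)"
      by (simp add: m_def algebra_simps power2_eq_square)
  qed
qed

lemma score_vector_iff_square_le_sum:
  "score_vector n s \<longleftrightarrow>
    (\<forall>I\<subseteq>{1..n}. int (card I) ^ 2 \<le> (\<Sum>i\<in>I. int n + s i)) \<and>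
    (\<forall>I\<subseteq>{1..n}. int (card I) ^ 2 \<le> (\<Sum>i\<in>I. int n - s i))"
proof -
  have "\<bar>\<Sum>i\<in>I. s i\<bar> \<le> int (card I) * (int n - int (card I)) \<longleftrightarrow>
      int (card I) ^ 2 \<le> (\<Sum>i\<in>I. int n + s i) \<and> int (card I) ^ 2 \<le> (\<Sum>i\<in>I. int n - s i)" for I
    by (auto simp: sum.distrib sum_subtractf abs_le_iff algebra_simps power2_eq_square)
  then show ?thesis
    unfolding score_vector_def by blast
qed

lemma frequency_vector_eq_card:
  assumes "s \<in> {1..n} \<rightarrow> {- int n + 1..int n - 1}"
  shows "frequency_vector n s d = card {i \<in> {1..n}. s i = d}"
proof (cases "d \<in> {- int n + 1..int n - 1}")
  case False
  then have "{i \<in> {1..n}. s i = d} = {}"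
    using assms by blast
  with False show ?thesis
    unfolding frequency_vector_def by (simp only: if_False card.empty)
qed (simp add: frequency_vector_def)

lemma sum_frequency_vector:
  assumes "s \<in> {1..n} \<rightarrow> {- int n + 1..int n - 1}"
  shows "(\<Sum>d\<in>{- int n + 1..int n - 1}. frequency_vector n s d) = n"
proof -
  have "s ` {1..n} \<subseteq> {- int n + 1..int n - 1}"
    using assms by blast
  from sum_fun_comp[OF _ _ this, of "\<lambda>_. 1 :: nat"] show ?thesis
    by (simp add: frequency_vector_eq_card[OF assms])
qed

lemma frequency_vector_uminus:
  "frequency_vector n (\<lambda>i. - s i) d = frequency_vector n s (- d)"
proof -
  have "{i \<in> {1..n}. - s i = d} = {i \<in> {1..n}. s i = - d}"
    by auto
  then show ?thesis
    by (auto simp: frequency_vector_def)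
qed

text \<open>Double counting: an index \<open>j\<close> contributes only to the term \<open>i = n + s j\<close>. Values of \<open>i\<close>
  above \<open>2 k\<close> are missing on the left and have vanishing positive part on the right; the lower end
  \<open>i = 1\<close> loses nothing because \<open>n + s j \<ge> 1\<close>.\<close>

lemma weighted_frequency_sum:
  assumes s: "s \<in> {1..n} \<rightarrow> {- int n + 1..int n - 1}"
  shows "(\<Sum>i=1..2*k. (2 * int k - int i + 1) * int (frequency_vector n s (- int n + int i))) =
    (\<Sum>j\<in>{1..n}. max 0 (2 * int k + 1 - (int n + s j)))"
proof -
  have "(\<Sum>i=1..2*k. (2 * int k - int i + 1) * int (frequency_vector n s (- int n + int i))) =
    (\<Sum>i=1..2*k. \<Sum>j\<in>{1..n}. if s j = - int n + int i then 2 * int k - int i + 1 else 0)"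
    by (simp add: frequency_vector_eq_card[OF s] sum.If_cases Int_def mult.commute)
  also have "\<dots> = (\<Sum>j\<in>{1..n}. \<Sum>i=1..2*k.
      if s j = - int n + int i then 2 * int k - int i + 1 else 0)"
    by (rule sum.swap)
  also have "\<dots> = (\<Sum>j\<in>{1..n}. max 0 (2 * int k + 1 - (int n + s j)))"
  proof (rule sum.cong)
    fix j assume "j \<in> {1..n}"
    then have "s j \<in> {- int n + 1..int n - 1}"
      using s by blast
    then have pos: "1 \<le> int n + s j"
      by simp
    have "(\<Sum>i=1..2*k. if s j = - int n + int i then 2 * int k - int i + 1 else 0) =
      (\<Sum>i=1..2*k. if i = nat (int n + s j) then 2 * int k + 1 - (int n + s j) else 0)"
      by (rule sum.cong) (use pos in auto)
    also have "\<dots> = max 0 (2 * int k + 1 - (int n + s j))"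
      using pos by (simp add: sum.delta max_def) linarith
    finally show "(\<Sum>i=1..2*k. if s j = - int n + int i then 2 * int k - int i + 1 else 0) =
      max 0 (2 * int k + 1 - (int n + s j))" .
  qed simp
  finally show ?thesis .
qed

theorem proposition2p1:
  fixes n :: nat and s :: "nat \<Rightarrow> int" and x :: "int \<Rightarrow> nat"
  assumes "n \<ge> 1"
    and "s \<in> {1..n} \<rightarrow> {- int n + 1..int n - 1}"
    and "x = frequency_vector n s"
  shows "score_vector n s \<longleftrightarrow>
    (\<Sum>d\<in>{- int n + 1..int n - 1}. x d) = n \<and>
    (\<forall>k\<in>{0..n}.
       (\<Sum>i=1..2*k. (2 * int k - int i + 1) * int (x (- int n + int i))) \<le> int k * (int k + 1) \<and>
       (\<Sum>i=1..2*k. (2 * int k - int i + 1) * int (x (int n - int i))) \<le> int k * (int k + 1))"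
proof -
  have lower: "(\<Sum>i=1..2*k. (2 * int k - int i + 1) * int (x (- int n + int i))) =
      (\<Sum>j\<in>{1..n}. max 0 (2 * int k + 1 - (int n + s j)))" for k
    unfolding assms(3) by (rule weighted_frequency_sum[OF assms(2)])
  \<comment> \<open>Negating \<open>s\<close> reverses the frequency vector and exchanges the two families.\<close>
  have "(\<lambda>i. - s i) \<in> {1..n} \<rightarrow> {- int n + 1..int n - 1}"
  proof
    fix i assume "i \<in> {1..n}"
    then have "s i \<in> {- int n + 1..int n - 1}"
      using assms(2) by blast
    then show "- s i \<in> {- int n + 1..int n - 1}"
      by auto
  qed
  from weighted_frequency_sum[OF this]
  have upper: "(\<Sum>i=1..2*k. (2 * int k - int i + 1) * int (x (int n - int i))) =
      (\<Sum>j\<in>{1..n}. max 0 (2 * int k + 1 - (int n - s j)))" for k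
    by (simp add: frequency_vector_uminus assms(3))
  show ?thesis
    unfolding lower upper score_vector_iff_square_le_sum
      square_le_sum_iff_excess_le[OF finite_atLeastAtMost]
    using sum_frequency_vector[OF assms(2)] assms(3) by auto
qed

end
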